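(* Consider the game Circular Nim $\mathrm{CN}(7,4)$ (defined in the context). A position $\mathbf p$ is a $\mathcal P$-position if and only if $\mathbf p\in S=S_1\cup S_2\cup S_3\cup S_4$, where, writing $\mathbf p=(a,b,c,d,e,f,g)$ in a representation with $a=\min(\mathbf p)$, - $S_1=\{\mathbf p \mid a=b=0,\ c=g>0,\ d+e+f=c\}$, - $S_2=\{\mathbf p \mid \mathbf p=(a,a,a,a,a,a,a)\}$, - $S_3=\{\mathbf p \mid a=b,\ c=g,\ d=f,\ a+c=d+e,\ 0<a<e\}$, - $S_4=\{\mathbf p \mid a=f,\ b+c=d+e=g+a,\ a<\min\{b,e\},\ a<\max\{c,d\}\}$.
   Context: Circular Nim $\mathrm{CN}(n,k)$: $n$ stacks of tokens are arranged in a circle; a position is a vector $\mathbf p=(p_1,\dots,p_n)$ of nonnegative integers giving the stack heights in order around the circle. A move consists of choosing $k$ cyclically consecutive stacks and removing at least one token from at least one of these $k$ stacks (any number of tokens may be removed from each of the chosen stacks, and stacks not chosen are unchanged). Under normal play, the last player able to move wins. A position is only determined up to rotation and reflection (reading the circle in either direction). A $\mathcal P$-position is one from which the player about to move loses under optimal play (the previous player wins); an $\mathcal N$-position is one from which the player about to move wins. A position $\mathbf p$ of $\mathrm{CN}(7,4)$ belongs to one of the sets $S_i$ if some rotation and/or reflection $(a,b,c,d,e,f,g)$ of $\mathbf p$ with $a=\min(\mathbf p)$ satisfies the listed conditions. *)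

theory Defs
  imports Main
begin

text \<open>Circular Nim CN(n,k). A position is a list of n stack heights, read around the circle.
  A move chooses k cyclically consecutive stacks (the window starting at index i) and removes
  tokens from them: the new position is pointwise \<le> the old one, differs from it, and agrees
  with it outside the window.\<close>

definition cn_window :: "nat \<Rightarrow> nat \<Rightarrow> nat \<Rightarrow> nat set" where
  "cn_window n k i = {(i + t) mod n | t. t < k}"

definition cn_move :: "nat \<Rightarrow> nat \<Rightarrow> nat list \<Rightarrow> nat list \<Rightarrow> bool" where
  "cn_move n k p q \<longleftrightarrow> length p = n \<and> length q = n \<and> q \<noteq> p
     \<and> (\<forall>j<n. q ! j \<le> p ! j)
     \<and> (\<exists>i<n. \<forall>j<n. j \<notin> cn_window n k i \<longrightarrow> q ! j = p ! j)"

lemma cn_move_sum_less: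
  assumes "cn_move n k p q" shows "sum_list q < sum_list p"
proof -
  from assms have l: "length p = n" "length q = n" and ne: "q \<noteq> p"
    and le: "\<forall>j<n. q ! j \<le> p ! j" by (auto simp: cn_move_def)
  from ne l obtain j where j: "j < n" "q ! j \<noteq> p ! j" by (metis nth_equalityI)
  have "(\<Sum>j<n. q ! j) < (\<Sum>j<n. p ! j)"
    using le j by (intro sum_strict_mono_ex1) (auto intro: le_neq_implies_less)
  then show ?thesis using l by (simp add: sum_list_sum_nth atLeast0LessThan)
qed

function cn_P :: "nat \<Rightarrow> nat \<Rightarrow> nat list \<Rightarrow> bool" where
  "cn_P n k p = (\<forall>q \<in> {q. cn_move n k p q}. \<not> cn_P n k q)"
  by auto
termination
  by (relation "measure (\<lambda>(n, k, p). sum_list p)") (auto dest: cn_move_sum_less)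

definition cn_reps :: "nat list \<Rightarrow> nat list set" where
  "cn_reps p = {rotate r p | r. True} \<union> {rotate r (rev p) | r. True}"

definition S1 :: "nat list set" where
  "S1 = {[a,b,c,d,e,f,g] | a b c d e f g. a = 0 \<and> b = 0 \<and> c = g \<and> c > 0 \<and> d + e + f = c}"

definition S2 :: "nat list set" where
  "S2 = {[a,b,c,d,e,f,g] | a b c d e f g. b = a \<and> c = a \<and> d = a \<and> e = a \<and> f = a \<and> g = a}"

definition S3 :: "nat list set" where
  "S3 = {[a,b,c,d,e,f,g] | a b c d e f g.
           a = b \<and> c = g \<and> d = f \<and> a + c = d + e \<and> 0 < a \<and> a < e}"

definition S4 :: "nat list set" where
  "S4 = {[a,b,c,d,e,f,g] | a b c d e f g.
           a = f \<and> b + c = d + e \<and> d + e = g + a \<and> a < min b e \<and> a < max c d}"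

definition cn74_S :: "nat list \<Rightarrow> bool" where
  "cn74_S p \<longleftrightarrow> (\<exists>x \<in> cn_reps p. hd x = Min (set p) \<and> x \<in> S1 \<union> S2 \<union> S3 \<union> S4)"

end

theory Submission
  imports Defs
begin

text \<open>
  A move fixes three consecutive stacks \<open>x, y, z\<close> and lowers the other four \<open>w1, ...,
  w4\<close>. Hence the theorem says that, for positions in \<open>S\<close> sharing such a triple, the four
  remaining entries are never comparable unless equal, and that every position has a triple for which the
  other four entries can be lowered (possibly not at all) to reach \<open>S\<close>. Each
  \<open>S\<^sub>i\<close> is invariant under reversing the circle about one particular stack, its axis;
  solving for the four free entries, according to \<open>i\<close> and the distance of the axis from
  \<open>y\<close>, gives nine sufficient linear conditions. For a position whose minimum sits at a fixed
  stack, the failure of these conditions for all seven triples in both reading directions is infeasible in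
  linear arithmetic.
\<close>

declare cn_P.simps [simp del]

section \<open>Symmetric reformulation of the set \<open>S\<close>\<close>

text \<open>
  The four families, read starting from the stack on their axis: \<open>(e,f,g,a,b,c,d)\<close> for
  \<open>S\<^sub>1\<close> and \<open>S\<^sub>3\<close>, \<open>(g,a,b,c,d,e,f)\<close> for \<open>S\<^sub>4\<close>. This makes the predicate invariant under reversal. The
  inequalities \<open>x1 \<le> x3\<close>, \<open>x1 \<le> x4\<close> (and \<open>x3 \<le> x1\<close>) express \<open>a = min p\<close>.
\<close>
definition axial_S :: "nat \<Rightarrow> nat \<Rightarrow> nat \<Rightarrow> nat \<Rightarrow> nat \<Rightarrow> nat \<Rightarrow> nat \<Rightarrow> bool" where
  "axial_S x0 x1 x2 x3 x4 x5 x6 \<longleftrightarrow>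
     x3 = 0 \<and> x4 = 0 \<and> x2 = x5 \<and> 0 < x2 \<and> x6 + x0 + x1 = x2
   \<or> x0 = x1 \<and> x1 = x2 \<and> x2 = x3 \<and> x3 = x4 \<and> x4 = x5 \<and> x5 = x6
   \<or> x3 = x4 \<and> x2 = x5 \<and> x1 = x6 \<and> x3 + x2 = x1 + x0 \<and> 0 < x3 \<and> x3 < x0 \<and> x3 \<le> x1
   \<or> x1 = x6 \<and> x2 + x3 = x0 + x1 \<and> x4 + x5 = x0 + x1 \<and> x1 < x2 \<and> x1 < x5
       \<and> x1 \<le> x3 \<and> x1 \<le> x4 \<and> (x1 < x3 \<or> x1 < x4)"

text \<open>Seven rotations suffice: each disjunct is unchanged by reversal about its axis
  (\<open>axial_S_reflect\<close>), so reflected readings are already covered.\<close>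

definition circ_S :: "nat \<Rightarrow> nat \<Rightarrow> nat \<Rightarrow> nat \<Rightarrow> nat \<Rightarrow> nat \<Rightarrow> nat \<Rightarrow> bool" where
  "circ_S x0 x1 x2 x3 x4 x5 x6 \<longleftrightarrow>
     axial_S x0 x1 x2 x3 x4 x5 x6 \<or> axial_S x1 x2 x3 x4 x5 x6 x0 \<or> axial_S x2 x3 x4 x5 x6 x0 x1
   \<or> axial_S x3 x4 x5 x6 x0 x1 x2 \<or> axial_S x4 x5 x6 x0 x1 x2 x3 \<or> axial_S x5 x6 x0 x1 x2 x3 x4
   \<or> axial_S x6 x0 x1 x2 x3 x4 x5"

text \<open>If \<open>x2 = 0\<close>, the equations make all seven stacks zero, and the constant
  disjunct applies instead.\<close>

lemma axial_S1I:
  assumes "x3 = 0" "x4 = 0" "x5 = x2" "x6 + x0 + x1 = x2"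
  shows "axial_S x0 x1 x2 x3 x4 x5 x6"
  using assms unfolding axial_S_def by (cases "x2 = 0") simp_all

lemma axial_S2I: "axial_S x x x x x x x"
  unfolding axial_S_def by simp

lemma axial_S3I:
  assumes "x4 = x3" "x5 = x2" "x6 = x1" "x3 + x2 = x1 + x0" "0 < x3" "x3 < x0" "x3 \<le> x1"
  shows "axial_S x0 x1 x2 x3 x4 x5 x6"
  using assms unfolding axial_S_def by simp

lemma axial_S4I:
  assumes "x6 = x1" "x2 + x3 = x0 + x1" "x4 + x5 = x0 + x1" "x1 < x2" "x1 < x5"
    "x1 \<le> x3" "x1 \<le> x4" "x1 < x3 \<or> x1 < x4"
  shows "axial_S x0 x1 x2 x3 x4 x5 x6"
  using assms unfolding axial_S_def by simp

lemma axial_S_reflect: "axial_S x0 x1 x2 x3 x4 x5 x6 \<longleftrightarrow> axial_S x0 x6 x5 x4 x3 x2 x1"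
proof -
  have "axial_S x0 x6 x5 x4 x3 x2 x1" if "axial_S x0 x1 x2 x3 x4 x5 x6" for x0 x1 x2 x3 x4 x5 x6
    using that [unfolded axial_S_def]
  proof (elim disjE conjE)
    assume "x3 = 0" "x4 = 0" "x2 = x5" "x6 + x0 + x1 = x2"
    then show ?thesis by (intro axial_S1I) simp_all
  next
    assume "x0 = x1" "x1 = x2" "x2 = x3" "x3 = x4" "x4 = x5" "x5 = x6"
    then show ?thesis by (simp add: axial_S2I)
  next
    assume "x3 = x4" "x2 = x5" "x1 = x6" "x3 + x2 = x1 + x0" "0 < x3" "x3 < x0" "x3 \<le> x1"
    then show ?thesis by (intro axial_S3I) simp_all
  qed (intro axial_S4I; simp)+
  then show ?thesis by blast
qed

lemma circ_S_rotate: "circ_S x0 x1 x2 x3 x4 x5 x6 \<longleftrightarrow> circ_S x1 x2 x3 x4 x5 x6 x0"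
  unfolding circ_S_def by blast

lemma circ_S_rotations:
  assumes "circ_S x0 x1 x2 x3 x4 x5 x6"
  shows "circ_S x1 x2 x3 x4 x5 x6 x0"
    and "circ_S x2 x3 x4 x5 x6 x0 x1"
    and "circ_S x3 x4 x5 x6 x0 x1 x2"
    and "circ_S x4 x5 x6 x0 x1 x2 x3"
    and "circ_S x5 x6 x0 x1 x2 x3 x4"
    and "circ_S x6 x0 x1 x2 x3 x4 x5"
  using assms unfolding circ_S_def by argo+

lemma circ_S_reflect: "circ_S x0 x1 x2 x3 x4 x5 x6 \<longleftrightarrow> circ_S x6 x5 x4 x3 x2 x1 x0"
  unfolding circ_S_def
  using axial_S_reflect [of x0 x1 x2 x3 x4 x5 x6] axial_S_reflect [of x1 x2 x3 x4 x5 x6 x0]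
    axial_S_reflect [of x2 x3 x4 x5 x6 x0 x1] axial_S_reflect [of x3 x4 x5 x6 x0 x1 x2]
    axial_S_reflect [of x4 x5 x6 x0 x1 x2 x3] axial_S_reflect [of x5 x6 x0 x1 x2 x3 x4]
    axial_S_reflect [of x6 x0 x1 x2 x3 x4 x5]
  by argo

section \<open>Stability: comparable members of \<open>S\<close> sharing a triple\<close>

lemma circ_S_window_unique:
  assumes "circ_S x y z w1 w2 w3 w4" "circ_S x y z v1 v2 v3 v4"
    and "v1 \<le> w1" "v2 \<le> w2" "v3 \<le> w3" "v4 \<le> w4"
  shows "v1 = w1 \<and> v2 = w2 \<and> v3 = w3 \<and> v4 = w4"
proof (rule ccontr)
  assume "\<not> ?thesis"
  \<comment> \<open>One linear inequality replaces the disjunction over which stack is strictly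
    lowered; each pair of axis position and family then contradicts it linearly.\<close>
  then have "v1 + v2 + v3 + v4 < w1 + w2 + w3 + w4" using assms(3-6) by linarith
  then show False
    using assms unfolding circ_S_def axial_S_def by (elim disjE conjE; linarith)
qed

section \<open>Conditions for lowering four stacks into \<open>S\<close>\<close>

text \<open>The bounds are weak, so a position already in \<open>S\<close> is completed by itself
  and \<open>completable_exists\<close> can hold without exception.\<close>

definition completable :: "nat \<Rightarrow> nat \<Rightarrow> nat \<Rightarrow> nat \<Rightarrow> nat \<Rightarrow> nat \<Rightarrow> nat \<Rightarrow> bool" where
  "completable x y z w1 w2 w3 w4 \<longleftrightarrow>
     (\<exists>v1 v2 v3 v4. v1 \<le> w1 \<and> v2 \<le> w2 \<and> v3 \<le> w3 \<and> v4 \<le> w4 \<and> circ_S x y z v1 v2 v3 v4)"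

lemma completable_reflect: "completable x y z w1 w2 w3 w4 \<longleftrightarrow> completable z y x w4 w3 w2 w1"
proof -
  have "circ_S x y z v1 v2 v3 v4 \<longleftrightarrow> circ_S z y x v4 v3 v2 v1" for v1 v2 v3 v4
    using circ_S_reflect [of x y z v1 v2 v3 v4] circ_S_rotate [of v4 v3 v2 v1 z y x]
      circ_S_rotate [of v3 v2 v1 z y x v4] circ_S_rotate [of v2 v1 z y x v4 v3]
      circ_S_rotate [of v1 z y x v4 v3 v2] by argo
  then show ?thesis unfolding completable_def by blast
qed

text \<open>One axis for each distance from \<open>y\<close>: \<open>y\<close>, \<open>x\<close>,
  \<open>v4\<close>, \<open>v3\<close> at distances 0, 1, 2, 3. The other three are mirror images,
  reached through \<open>completable_reflect\<close>.\<close>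

lemma completableI:
  assumes "v1 \<le> w1" "v2 \<le> w2" "v3 \<le> w3" "v4 \<le> w4"
    and "axial_S x y z v1 v2 v3 v4 \<or> axial_S y z v1 v2 v3 v4 x
      \<or> axial_S v3 v4 x y z v1 v2 \<or> axial_S v4 x y z v1 v2 v3"
  shows "completable x y z w1 w2 w3 w4"
  using assms unfolding completable_def circ_S_def by blast

text \<open>In \<open>completable_Si_k\<close>, the target lies in \<open>S\<^sub>i\<close> and its axis is \<open>k\<close> stacks away from \<open>y\<close>.\<close>

lemma completable_S1_0:
  assumes "x + y + z \<le> w1" "x + y + z \<le> w4"
  shows "completable x y z w1 w2 w3 w4"
proof -
  have "axial_S y z (x + y + z) 0 0 (x + y + z) x" by (rule axial_S1I) simp_all
  then show ?thesis
    by (intro completableI [of "x + y + z" _ 0 _ 0 _ "x + y + z"]) (use assms in auto)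
qed

lemma completable_S1_1:
  assumes "x + y \<le> z" "z \<le> w3" "z \<le> w4 + x + y"
  shows "completable x y z w1 w2 w3 w4"
proof -
  have "axial_S x y z 0 0 z (z - (x + y))" by (rule axial_S1I) (use assms in simp_all)
  then show ?thesis
    by (intro completableI [of 0 _ 0 _ z _ "z - (x + y)"]) (use assms in auto)
qed

lemma completable_S1_2:
  assumes "z = 0" "x \<le> y" "y \<le> w2" "y \<le> w3 + w4 + x"
  shows "completable x y z w1 w2 w3 w4"
proof -
  \<comment> \<open>The third and fourth free entries must add up to \<open>y - x\<close>: the third
    is filled first, the fourth takes the rest.\<close>
  define d where "d = min w3 (y - x)"
  have d: "d \<le> w3" "y - x - d \<le> w4" "d \<le> y - x" using assms unfolding d_def by auto
  have "axial_S (y - x - d) x y z 0 y d" by (rule axial_S1I) (use assms d in simp_all)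
  then show ?thesis
    by (intro completableI [of 0 _ y _ d _ "y - x - d"]) (use assms d in auto)
qed

lemma completable_S1_3:
  assumes "y = 0" "z = 0" "x \<le> w1" "x \<le> w2 + w3 + w4"
  shows "completable x y z w1 w2 w3 w4"
proof -
  \<comment> \<open>The last three free entries must add up to \<open>x\<close> and are filled
    greedily in order.\<close>
  define d where "d = min w2 x"
  define e where "e = min w3 (x - d)"
  have d: "d \<le> w2" "e \<le> w3" "x - d - e \<le> w4" "d \<le> x" "e \<le> x - d"
    using assms unfolding d_def e_def by auto
  have "axial_S e (x - d - e) x y z x d" by (rule axial_S1I) (use assms d in simp_all)
  then show ?thesis
    by (intro completableI [of x _ d _ e _ "x - d - e"]) (use assms d in auto)
qed

lemma completable_S2:
  assumes "y = x" "z = x" "x \<le> w1" "x \<le> w2" "x \<le> w3" "x \<le> w4"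
  shows "completable x y z w1 w2 w3 w4"
  using assms axial_S2I by (intro completableI [of x _ x _ x _ x]) auto

text \<open>With axis \<open>x\<close> the minimum has to be \<open>x + y - z\<close>; the first
  three hypotheses make it positive, below \<open>x\<close> and at most \<open>y\<close>.\<close>

lemma completable_S3_1:
  assumes "z < x + y" "y < z" "x \<le> z" "x + y \<le> w1 + z" "x + y \<le> w2 + z" "z \<le> w3" "y \<le> w4"
  shows "completable x y z w1 w2 w3 w4"
proof -
  have "axial_S x y z (x + y - z) (x + y - z) z y" by (rule axial_S3I) (use assms in auto)
  then show ?thesis
    by (intro completableI [of "x + y - z" _ "x + y - z" _ z _ y]) (use assms in auto)
qed

lemma completable_S3_2:
  assumes "0 < z" "x < y" "z \<le> x" "z \<le> w1" "y \<le> w2" "x \<le> w3" "z + y \<le> w4 + x"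
  shows "completable x y z w1 w2 w3 w4"
proof -
  have "axial_S (z + y - x) x y z z y x" by (rule axial_S3I) (use assms in auto)
  then show ?thesis
    by (intro completableI [of z _ y _ x _ "z + y - x"]) (use assms in auto)
qed

lemma completable_S4_1:
  assumes "y < z" "z \<le> x" "x + y \<le> w1 + z" "y \<le> w2" "y < w3" "y \<le> w4" "x + y \<le> w2 + w3"
    and "z < x \<or> y < w2 \<and> y + 2 \<le> x"
  shows "completable x y z w1 w2 w3 w4"
proof -
  \<comment> \<open>\<open>d\<close> is the least value above the minimum \<open>y\<close> whose
    partner \<open>x + y - d\<close> fits below \<open>w3\<close>. If \<open>w2 = y\<close> leaves
    no room above \<open>y\<close>, then \<open>d = y\<close> and strictness comes from
    \<open>z < x\<close>.\<close>
  define d where "d = (if y < w2 then max (y + 1) (x + y - w3) else y)"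
  have d: "d \<le> w2" "y \<le> d" "x + y \<le> d + w3" "d < x" "z < x \<or> y < d"
    using assms unfolding d_def by auto
  have "axial_S x y z (x + y - z) d (x + y - d) y" by (rule axial_S4I) (use assms d in auto)
  then show ?thesis
    by (intro completableI [of "x + y - z" _ d _ "x + y - d" _ y]) (use assms d in auto)
qed

text \<open>The axis is the free entry below \<open>w3\<close>, and \<open>x + y\<close> is the
  common sum. The last hypothesis spells out that the minimum \<open>x + y - w3\<close>, truncated
  at 0, is below \<open>y\<close> or below \<open>z\<close>.\<close>

lemma completable_S4_3:
  assumes "x + y \<le> w1 + z" "x + y \<le> w2 + w3" "x + y \<le> w4 + w3" "0 < x" "y < w3"
    and "z < x + y" "z < w3" "x \<le> w3" "x + y \<le> z + w3"
    and "0 < y \<and> x < w3 \<or> 0 < z \<and> x + y < z + w3"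
  shows "completable x y z w1 w2 w3 w4"
proof -
  \<comment> \<open>the smallest minimum for which the axis stack \<open>x + y - a\<close> fits below \<open>w3\<close>; truncated at 0\<close>
  define a where "a = x + y - w3"
  have a: "a \<le> w2" "a \<le> w4" "x + y \<le> a + w3" "a < x" "a + z < x + y" "a \<le> y" "a \<le> z"
    "a < y \<or> a < z"
    using assms unfolding a_def by auto
  have "axial_S (x + y - a) a x y z (x + y - z) a" by (rule axial_S4I) (use assms(1) a in auto)
  then show ?thesis
    by (intro completableI [of "x + y - z" _ a _ "x + y - a" _ a]) (use assms(1) a in auto)
qed

section \<open>The conditions cover every position\<close>

text \<open>Polymorphic because the SMT replay below is only fast over the integers.\<close>
definition window_test :: "'a::linordered_semidom \<Rightarrow> 'a \<Rightarrow> 'a \<Rightarrow> 'a \<Rightarrow> 'a \<Rightarrow> 'a \<Rightarrow> 'a \<Rightarrow> bool" where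
  "window_test x y z w1 w2 w3 w4 \<longleftrightarrow>
     x + y + z \<le> w1 \<and> x + y + z \<le> w4
   \<or> x + y \<le> z \<and> z \<le> w3 \<and> z \<le> w4 + x + y
   \<or> z = 0 \<and> x \<le> y \<and> y \<le> w2 \<and> y \<le> w3 + w4 + x
   \<or> y = 0 \<and> z = 0 \<and> x \<le> w1 \<and> x \<le> w2 + w3 + w4
   \<or> y = x \<and> z = x \<and> x \<le> w1 \<and> x \<le> w2 \<and> x \<le> w3 \<and> x \<le> w4
   \<or> z < x + y \<and> y < z \<and> x \<le> z \<and> x + y \<le> w1 + z \<and> x + y \<le> w2 + z \<and> z \<le> w3 \<and> y \<le> w4
   \<or> 0 < z \<and> x < y \<and> z \<le> x \<and> z \<le> w1 \<and> y \<le> w2 \<and> x \<le> w3 \<and> z + y \<le> w4 + x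
   \<or> y < z \<and> z \<le> x \<and> x + y \<le> w1 + z \<and> y \<le> w2 \<and> y < w3 \<and> y \<le> w4 \<and> x + y \<le> w2 + w3
           \<and> (z < x \<or> y < w2 \<and> y + 2 \<le> x)
   \<or> x + y \<le> w1 + z \<and> x + y \<le> w2 + w3 \<and> x + y \<le> w4 + w3 \<and> 0 < x \<and> y < w3
           \<and> z < x + y \<and> z < w3 \<and> x \<le> w3 \<and> x + y \<le> z + w3
           \<and> (0 < y \<and> x < w3 \<or> 0 < z \<and> x + y < z + w3)"

lemma window_test_of_nat:
  "window_test (int x) (int y) (int z) (int w1) (int w2) (int w3) (int w4) \<longleftrightarrow> window_test x y z w1 w2 w3 w4"
  unfolding window_test_def
  by (simp only: of_nat_le_iff of_nat_less_iff of_nat_eq_iff of_nat_0_less_iff of_nat_eq_0_iff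
      of_nat_add [symmetric] of_nat_numeral [where 'a = int, symmetric])

lemma window_test_imp_completable: "window_test x y z w1 w2 w3 w4 \<Longrightarrow> completable x y z w1 w2 w3 w4"
  unfolding window_test_def
  by (elim disjE; elim conjE;
     (rule completable_S1_0; assumption
    | rule completable_S1_1; assumption
    | rule completable_S1_2; assumption
    | rule completable_S1_3; assumption
    | rule completable_S2; assumption
    | rule completable_S3_1; assumption
    | rule completable_S3_2; assumption
    | rule completable_S4_1; assumption
    | rule completable_S4_3; assumption))

text \<open>The last seven disjuncts are the mirror images of the first seven, in the same order and
  in the form of \<open>completable_reflect\<close>.\<close>

lemma window_test_exists_min:
  fixes x0 x1 x2 x3 x4 x5 x6 :: int
  assumes "0 \<le> x0" "x0 \<le> x1" "x0 \<le> x2" "x0 \<le> x3" "x0 \<le> x4" "x0 \<le> x5" "x0 \<le> x6"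
  shows "window_test x0 x1 x2 x3 x4 x5 x6
      \<or> window_test x1 x2 x3 x4 x5 x6 x0
      \<or> window_test x2 x3 x4 x5 x6 x0 x1
      \<or> window_test x3 x4 x5 x6 x0 x1 x2
      \<or> window_test x4 x5 x6 x0 x1 x2 x3
      \<or> window_test x5 x6 x0 x1 x2 x3 x4
      \<or> window_test x6 x0 x1 x2 x3 x4 x5
      \<or> window_test x2 x1 x0 x6 x5 x4 x3
      \<or> window_test x3 x2 x1 x0 x6 x5 x4
      \<or> window_test x4 x3 x2 x1 x0 x6 x5
      \<or> window_test x5 x4 x3 x2 x1 x0 x6
      \<or> window_test x6 x5 x4 x3 x2 x1 x0
      \<or> window_test x0 x6 x5 x4 x3 x2 x1
      \<or> window_test x1 x0 x6 x5 x4 x3 x2"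
  using assms unfolding window_test_def by (smt (z3))

lemma completable_exists_min:
  assumes "x0 \<le> x1" "x0 \<le> x2" "x0 \<le> x3" "x0 \<le> x4" "x0 \<le> x5" "x0 \<le> x6"
  shows "completable x0 x1 x2 x3 x4 x5 x6
      \<or> completable x1 x2 x3 x4 x5 x6 x0
      \<or> completable x2 x3 x4 x5 x6 x0 x1
      \<or> completable x3 x4 x5 x6 x0 x1 x2
      \<or> completable x4 x5 x6 x0 x1 x2 x3
      \<or> completable x5 x6 x0 x1 x2 x3 x4
      \<or> completable x6 x0 x1 x2 x3 x4 x5"
  using window_test_exists_min [of "int x0" "int x1" "int x2" "int x3" "int x4" "int x5" "int x6"] assms
    completable_reflect
  unfolding window_test_of_nat of_nat_le_iff by (auto dest!: window_test_imp_completable)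

text \<open>Rotation merely permutes the disjuncts, so the minimum may be taken to be the first
  stack.\<close>

lemma completable_exists: "completable x0 x1 x2 x3 x4 x5 x6
      \<or> completable x1 x2 x3 x4 x5 x6 x0
      \<or> completable x2 x3 x4 x5 x6 x0 x1
      \<or> completable x3 x4 x5 x6 x0 x1 x2
      \<or> completable x4 x5 x6 x0 x1 x2 x3
      \<or> completable x5 x6 x0 x1 x2 x3 x4
      \<or> completable x6 x0 x1 x2 x3 x4 x5"
proof -
  define m where "m = Min {x0, x1, x2, x3, x4, x5, x6}"
  have le: "m \<le> x0" "m \<le> x1" "m \<le> x2" "m \<le> x3" "m \<le> x4" "m \<le> x5" "m \<le> x6"
    unfolding m_def by (rule Min_le; simp)+
  have "m \<in> {x0, x1, x2, x3, x4, x5, x6}"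
    unfolding m_def by (rule Min_in) simp_all
  then consider "m = x0" | "m = x1" | "m = x2" | "m = x3" | "m = x4" | "m = x5" | "m = x6"
    by blast
  then show ?thesis
  proof cases
    case 1
    have "completable x0 x1 x2 x3 x4 x5 x6
      \<or> completable x1 x2 x3 x4 x5 x6 x0
      \<or> completable x2 x3 x4 x5 x6 x0 x1
      \<or> completable x3 x4 x5 x6 x0 x1 x2
      \<or> completable x4 x5 x6 x0 x1 x2 x3
      \<or> completable x5 x6 x0 x1 x2 x3 x4
      \<or> completable x6 x0 x1 x2 x3 x4 x5"
      using le unfolding \<open>m = x0\<close> by (intro completable_exists_min)
    then show ?thesis by blast
  next
    case 2
    have "completable x1 x2 x3 x4 x5 x6 x0
      \<or> completable x2 x3 x4 x5 x6 x0 x1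
      \<or> completable x3 x4 x5 x6 x0 x1 x2
      \<or> completable x4 x5 x6 x0 x1 x2 x3
      \<or> completable x5 x6 x0 x1 x2 x3 x4
      \<or> completable x6 x0 x1 x2 x3 x4 x5
      \<or> completable x0 x1 x2 x3 x4 x5 x6"
      using le unfolding \<open>m = x1\<close> by (intro completable_exists_min)
    then show ?thesis by blast
  next
    case 3
    have "completable x2 x3 x4 x5 x6 x0 x1
      \<or> completable x3 x4 x5 x6 x0 x1 x2
      \<or> completable x4 x5 x6 x0 x1 x2 x3
      \<or> completable x5 x6 x0 x1 x2 x3 x4
      \<or> completable x6 x0 x1 x2 x3 x4 x5
      \<or> completable x0 x1 x2 x3 x4 x5 x6
      \<or> completable x1 x2 x3 x4 x5 x6 x0"
      using le unfolding \<open>m = x2\<close> by (intro completable_exists_min)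
    then show ?thesis by blast
  next
    case 4
    have "completable x3 x4 x5 x6 x0 x1 x2
      \<or> completable x4 x5 x6 x0 x1 x2 x3
      \<or> completable x5 x6 x0 x1 x2 x3 x4
      \<or> completable x6 x0 x1 x2 x3 x4 x5
      \<or> completable x0 x1 x2 x3 x4 x5 x6
      \<or> completable x1 x2 x3 x4 x5 x6 x0
      \<or> completable x2 x3 x4 x5 x6 x0 x1"
      using le unfolding \<open>m = x3\<close> by (intro completable_exists_min)
    then show ?thesis by blast
  next
    case 5
    have "completable x4 x5 x6 x0 x1 x2 x3
      \<or> completable x5 x6 x0 x1 x2 x3 x4
      \<or> completable x6 x0 x1 x2 x3 x4 x5
      \<or> completable x0 x1 x2 x3 x4 x5 x6
      \<or> completable x1 x2 x3 x4 x5 x6 x0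
      \<or> completable x2 x3 x4 x5 x6 x0 x1
      \<or> completable x3 x4 x5 x6 x0 x1 x2"
      using le unfolding \<open>m = x4\<close> by (intro completable_exists_min)
    then show ?thesis by blast
  next
    case 6
    have "completable x5 x6 x0 x1 x2 x3 x4
      \<or> completable x6 x0 x1 x2 x3 x4 x5
      \<or> completable x0 x1 x2 x3 x4 x5 x6
      \<or> completable x1 x2 x3 x4 x5 x6 x0
      \<or> completable x2 x3 x4 x5 x6 x0 x1
      \<or> completable x3 x4 x5 x6 x0 x1 x2
      \<or> completable x4 x5 x6 x0 x1 x2 x3"
      using le unfolding \<open>m = x5\<close> by (intro completable_exists_min)
    then show ?thesis by blast
  next
    case 7
    have "completable x6 x0 x1 x2 x3 x4 x5
      \<or> completable x0 x1 x2 x3 x4 x5 x6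
      \<or> completable x1 x2 x3 x4 x5 x6 x0
      \<or> completable x2 x3 x4 x5 x6 x0 x1
      \<or> completable x3 x4 x5 x6 x0 x1 x2
      \<or> completable x4 x5 x6 x0 x1 x2 x3
      \<or> completable x5 x6 x0 x1 x2 x3 x4"
      using le unfolding \<open>m = x6\<close> by (intro completable_exists_min)
    then show ?thesis by blast
  qed
qed

section \<open>Existence and uniqueness for all seven triples\<close>

lemma circ_S_below_exists:
  "\<exists>y0 y1 y2 y3 y4 y5 y6. circ_S y0 y1 y2 y3 y4 y5 y6 \<and> y0 \<le> x0 \<and> y1 \<le> x1 \<and> y2 \<le> x2 \<and> y3 \<le> x3 \<and> y4 \<le> x4 \<and> y5 \<le> x5 \<and> y6 \<le> x6
    \<and> (y0 = x0 \<and> y1 = x1 \<and> y2 = x2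
      \<or> y1 = x1 \<and> y2 = x2 \<and> y3 = x3
      \<or> y2 = x2 \<and> y3 = x3 \<and> y4 = x4
      \<or> y3 = x3 \<and> y4 = x4 \<and> y5 = x5
      \<or> y4 = x4 \<and> y5 = x5 \<and> y6 = x6
      \<or> y5 = x5 \<and> y6 = x6 \<and> y0 = x0
      \<or> y6 = x6 \<and> y0 = x0 \<and> y1 = x1)"
proof -
  have step: thesis if "completable x y z w1 w2 w3 w4"
      "\<And>v1 v2 v3 v4. circ_S x y z v1 v2 v3 v4 \<Longrightarrow> v1 \<le> w1 \<Longrightarrow> v2 \<le> w2 \<Longrightarrow> v3 \<le> w3 \<Longrightarrow> v4 \<le> w4 \<Longrightarrow> thesis"
    for x y z w1 w2 w3 w4 thesis
    using that unfolding completable_def by blast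
  from completable_exists [of x0 x1 x2 x3 x4 x5 x6] show ?thesis
    \<comment> \<open>Each witness is read from its fixed triple onwards;
      \<open>circ_S_rotations\<close> turns it back to the original first stack.\<close>
    by (elim disjE; elim step) (blast dest: circ_S_rotations)+
qed

lemma circ_S_below_unique:
  assumes "circ_S x0 x1 x2 x3 x4 x5 x6" "circ_S y0 y1 y2 y3 y4 y5 y6"
    and "y0 \<le> x0 \<and> y1 \<le> x1 \<and> y2 \<le> x2 \<and> y3 \<le> x3 \<and> y4 \<le> x4 \<and> y5 \<le> x5 \<and> y6 \<le> x6"
    and "y0 = x0 \<and> y1 = x1 \<and> y2 = x2
      \<or> y1 = x1 \<and> y2 = x2 \<and> y3 = x3
      \<or> y2 = x2 \<and> y3 = x3 \<and> y4 = x4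
      \<or> y3 = x3 \<and> y4 = x4 \<and> y5 = x5
      \<or> y4 = x4 \<and> y5 = x5 \<and> y6 = x6
      \<or> y5 = x5 \<and> y6 = x6 \<and> y0 = x0
      \<or> y6 = x6 \<and> y0 = x0 \<and> y1 = x1"
  shows "[y0,y1,y2,y3,y4,y5,y6] = [x0,x1,x2,x3,x4,x5,x6]"
  using assms(4)
proof (elim disjE conjE)
  assume eq: "y0 = x0" "y1 = x1" "y2 = x2"
  have "circ_S x0 x1 x2 x3 x4 x5 x6" "circ_S x0 x1 x2 y3 y4 y5 y6"
    using assms(1,2) circ_S_rotations eq by metis+
  from circ_S_window_unique [OF this] show ?thesis using assms(3) eq by simp
next
  assume eq: "y1 = x1" "y2 = x2" "y3 = x3"
  have "circ_S x1 x2 x3 x4 x5 x6 x0" "circ_S x1 x2 x3 y4 y5 y6 y0"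
    using assms(1,2) circ_S_rotations eq by metis+
  from circ_S_window_unique [OF this] show ?thesis using assms(3) eq by simp
next
  assume eq: "y2 = x2" "y3 = x3" "y4 = x4"
  have "circ_S x2 x3 x4 x5 x6 x0 x1" "circ_S x2 x3 x4 y5 y6 y0 y1"
    using assms(1,2) circ_S_rotations eq by metis+
  from circ_S_window_unique [OF this] show ?thesis using assms(3) eq by simp
next
  assume eq: "y3 = x3" "y4 = x4" "y5 = x5"
  have "circ_S x3 x4 x5 x6 x0 x1 x2" "circ_S x3 x4 x5 y6 y0 y1 y2"
    using assms(1,2) circ_S_rotations eq by metis+
  from circ_S_window_unique [OF this] show ?thesis using assms(3) eq by simp
next
  assume eq: "y4 = x4" "y5 = x5" "y6 = x6"
  have "circ_S x4 x5 x6 x0 x1 x2 x3" "circ_S x4 x5 x6 y0 y1 y2 y3"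
    using assms(1,2) circ_S_rotations eq by metis+
  from circ_S_window_unique [OF this] show ?thesis using assms(3) eq by simp
next
  assume eq: "y5 = x5" "y6 = x6" "y0 = x0"
  have "circ_S x5 x6 x0 x1 x2 x3 x4" "circ_S x5 x6 x0 y1 y2 y3 y4"
    using assms(1,2) circ_S_rotations eq by metis+
  from circ_S_window_unique [OF this] show ?thesis using assms(3) eq by simp
next
  assume eq: "y6 = x6" "y0 = x0" "y1 = x1"
  have "circ_S x6 x0 x1 x2 x3 x4 x5" "circ_S x6 x0 x1 y2 y3 y4 y5"
    using assms(1,2) circ_S_rotations eq by metis+
  from circ_S_window_unique [OF this] show ?thesis using assms(3) eq by simp
qed

section \<open>Moves of CN(7,4) in coordinates\<close>

lemma cn_window_7_4: "cn_window 7 4 i = {i mod 7, (i + 1) mod 7, (i + 2) mod 7, (i + 3) mod 7}"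
proof -
  have "cn_window 7 4 i = (\<lambda>t. (i + t) mod 7) ` {..<4}"
    unfolding cn_window_def by auto
  also have "{..<4::nat} = {0, 1, 2, 3}" by auto
  finally show ?thesis by simp
qed

lemma cn_move_7_4_iff:
  "cn_move 7 4 [x0,x1,x2,x3,x4,x5,x6] [y0,y1,y2,y3,y4,y5,y6] \<longleftrightarrow>
    [y0,y1,y2,y3,y4,y5,y6] \<noteq> [x0,x1,x2,x3,x4,x5,x6] \<and> (y0 \<le> x0 \<and> y1 \<le> x1 \<and> y2 \<le> x2 \<and> y3 \<le> x3 \<and> y4 \<le> x4 \<and> y5 \<le> x5 \<and> y6 \<le> x6)
    \<and> (y0 = x0 \<and> y1 = x1 \<and> y2 = x2
      \<or> y1 = x1 \<and> y2 = x2 \<and> y3 = x3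
      \<or> y2 = x2 \<and> y3 = x3 \<and> y4 = x4
      \<or> y3 = x3 \<and> y4 = x4 \<and> y5 = x5
      \<or> y4 = x4 \<and> y5 = x5 \<and> y6 = x6
      \<or> y5 = x5 \<and> y6 = x6 \<and> y0 = x0
      \<or> y6 = x6 \<and> y0 = x0 \<and> y1 = x1)"
proof -
  have all7: "(\<forall>j<7. P j) \<longleftrightarrow> P 0 \<and> P 1 \<and> P 2 \<and> P 3 \<and> P 4 \<and> P 5 \<and> P 6" for P :: "nat \<Rightarrow> bool"
    by (auto simp: numeral_eq_Suc All_less_Suc)
  \<comment> \<open>Window starts are listed from 3, so that the complementary untouched triples
    come out in the order 012, 123, ..., 601.\<close>
  have ex7: "(\<exists>j<7. P j) \<longleftrightarrow> P 3 \<or> P 4 \<or> P 5 \<or> P 6 \<or> P 0 \<or> P 1 \<or> P 2" for P :: "nat \<Rightarrow> bool"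
    by (auto simp: numeral_eq_Suc Ex_less_Suc)
  show ?thesis
    unfolding cn_move_def cn_window_7_4 all7 ex7 by (simp add: conj_ac)
qed

section \<open>Agreement with the given description of \<open>S\<close>\<close>

definition circ_list :: "nat list \<Rightarrow> bool" where
  "circ_list p \<longleftrightarrow> circ_S (p ! 0) (p ! 1) (p ! 2) (p ! 3) (p ! 4) (p ! 5) (p ! 6)"

lemma length_7E:
  assumes "length p = 7"
  obtains x0 x1 x2 x3 x4 x5 x6 where "p = [x0,x1,x2,x3,x4,x5,x6]"
  using assms by (auto simp: numeral_eq_Suc length_Suc_conv)

lemma circ_list_rotate: "length p = 7 \<Longrightarrow> circ_list (rotate r p) \<longleftrightarrow> circ_list p"
proof (induction r)
  case (Suc r)
  have "length (rotate r p) = 7" using Suc.prems by simp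
  then obtain x0 x1 x2 x3 x4 x5 x6 where "rotate r p = [x0,x1,x2,x3,x4,x5,x6]"
    by (rule length_7E)
  then show ?case
    using Suc circ_S_rotate [of x0 x1 x2 x3 x4 x5 x6] by (simp add: circ_list_def)
qed simp

lemma circ_list_rev: "length p = 7 \<Longrightarrow> circ_list (rev p) \<longleftrightarrow> circ_list p"
  using circ_S_reflect by (elim length_7E) (simp add: circ_list_def)

text \<open>Minimality of the head supplies the weak bounds that \<open>axial_S\<close> states
  explicitly: \<open>a \<le> f\<close> for \<open>S3\<close>, \<open>a \<le> c\<close> and
  \<open>a \<le> d\<close> for \<open>S4\<close>.\<close>

lemma circ_list_if_S:
  assumes "hd p = Min (set p)" "p \<in> S1 \<union> S2 \<union> S3 \<union> S4"
  shows "circ_list p"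
proof -
  have "length p = 7" using assms(2) by (auto simp: S1_def S2_def S3_def S4_def)
  then obtain a b c d e f g where p: "p = [a,b,c,d,e,f,g]" by (rule length_7E)
  have min: "a \<le> b" "a \<le> c" "a \<le> d" "a \<le> e" "a \<le> f" "a \<le> g"
    using assms(1) unfolding p by (auto simp: min_def split: if_splits)
  from assms(2) consider "p \<in> S1" | "p \<in> S2" | "p \<in> S3" | "p \<in> S4" by blast
  then have "axial_S e f g a b c d \<or> axial_S g a b c d e f"
  proof cases
    case 1
    then show ?thesis unfolding p S1_def by (intro disjI1 axial_S1I) auto
  next
    case 2
    then show ?thesis unfolding p S2_def by (auto intro: axial_S2I)
  next
    case 3
    then show ?thesis using min unfolding p S3_def by (intro disjI1 axial_S3I) auto
  next
    case 4
    then show ?thesis using min unfolding p S4_def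
      by (intro disjI2, intro axial_S4I) (auto simp: less_max_iff_disj)
  qed
  then show ?thesis unfolding p circ_list_def circ_S_def by auto
qed

lemma cn74_S_if_axial:
  assumes "rotate k p = [x0,x1,x2,x3,x4,x5,x6]" "axial_S x0 x1 x2 x3 x4 x5 x6"
  shows "cn74_S p"
proof -
  have rep: "rotate r [x0,x1,x2,x3,x4,x5,x6] \<in> cn_reps p" for r
    unfolding assms(1) [symmetric] cn_reps_def rotate_rotate by blast
  have set: "set p = {x0,x1,x2,x3,x4,x5,x6}"
    using arg_cong [OF assms(1), of set] by simp
  \<comment> \<open>The stack \<open>a\<close> comes three places after the axis for
    \<open>S1\<close> to \<open>S3\<close>, and one place after it for \<open>S4\<close>.\<close>
  have reps: "[x3,x4,x5,x6,x0,x1,x2] \<in> cn_reps p" "[x1,x2,x3,x4,x5,x6,x0] \<in> cn_reps p"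
    using rep [of 3] rep [of 1] by (simp_all add: numeral_eq_Suc)
  have Min: "m = Min (set p)" if "m \<in> set p" "\<forall>x \<in> set p. m \<le> x" for m
    using that by (intro Min_eqI [symmetric]) auto
  \<comment> \<open>The bounds in \<open>axial_S\<close>, combined with its equations, make the new
    head a global minimum, as \<open>cn74_S\<close> demands.\<close>
  from assms(2) [unfolded axial_S_def] consider
      (1) "[x3,x4,x5,x6,x0,x1,x2] \<in> S1 \<union> S2 \<union> S3" "\<forall>x \<in> set p. x3 \<le> x"
    | (4) "[x1,x2,x3,x4,x5,x6,x0] \<in> S4" "\<forall>x \<in> set p. x1 \<le> x"
    unfolding set S1_def S2_def S3_def S4_def
    by (elim disjE) auto
  then show ?thesis
  proof cases
    case 1
    then show ?thesis
      unfolding cn74_S_def by (intro bexI [OF _ reps(1)] conjI) (auto intro: Min simp: set)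
  next
    case 4
    then show ?thesis
      unfolding cn74_S_def by (intro bexI [OF _ reps(2)] conjI) (auto intro: Min simp: set)
  qed
qed

lemma cn74_S_iff_circ_list:
  assumes "length p = 7"
  shows "cn74_S p \<longleftrightarrow> circ_list p"
proof
  assume "cn74_S p"
  then obtain x where x: "x \<in> cn_reps p" "hd x = Min (set p)" "x \<in> S1 \<union> S2 \<union> S3 \<union> S4"
    unfolding cn74_S_def by blast
  from x(1) have "set x = set p" and "circ_list x \<longleftrightarrow> circ_list p"
    using assms by (auto simp: cn_reps_def circ_list_rotate circ_list_rev)
  with x(2,3) circ_list_if_S [of x] show "circ_list p" by simp
next
  assume p: "circ_list p"
  obtain x0 x1 x2 x3 x4 x5 x6 where eq: "p = [x0,x1,x2,x3,x4,x5,x6]"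
    using assms by (rule length_7E)
  have rot: "rotate 0 p = [x0,x1,x2,x3,x4,x5,x6]"
    "rotate 1 p = [x1,x2,x3,x4,x5,x6,x0]"
    "rotate 2 p = [x2,x3,x4,x5,x6,x0,x1]"
    "rotate 3 p = [x3,x4,x5,x6,x0,x1,x2]"
    "rotate 4 p = [x4,x5,x6,x0,x1,x2,x3]"
    "rotate 5 p = [x5,x6,x0,x1,x2,x3,x4]"
    "rotate 6 p = [x6,x0,x1,x2,x3,x4,x5]"
    unfolding eq by (simp_all add: numeral_eq_Suc)
  from p show "cn74_S p"
    unfolding circ_list_def circ_S_def using rot [THEN cn74_S_if_axial]
    by (auto simp: eq)
qed

section \<open>Kernels of the move relation and the theorem\<close>

text \<open>A stable and absorbing set is a kernel of the move graph. It is determined by induction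
  on the total number of tokens, which every move lowers.\<close>

lemma cn_P_iff_kernel:
  assumes stable: "\<And>p q. length p = n \<Longrightarrow> K p \<Longrightarrow> cn_move n k p q \<Longrightarrow> \<not> K q"
    and absorbing: "\<And>p. length p = n \<Longrightarrow> \<not> K p \<Longrightarrow> \<exists>q. cn_move n k p q \<and> K q"
    and "length p = n"
  shows "cn_P n k p \<longleftrightarrow> K p"
  using assms(3)
proof (induction p rule: measure_induct_rule [of sum_list])
  case (less p)
  have "cn_P n k q \<longleftrightarrow> K q" if "cn_move n k p q" for q
    using less.IH [OF cn_move_sum_less [OF that]] that by (simp add: cn_move_def)
  then have "cn_P n k p \<longleftrightarrow> (\<forall>q. cn_move n k p q \<longrightarrow> \<not> K q)"
    by (subst cn_P.simps) auto
  then show ?case using stable absorbing less.prems by blast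
qed

theorem theorem2:
  fixes p :: "nat list"
  assumes "length p = 7"
  shows "cn_P 7 4 p \<longleftrightarrow> cn74_S p"
proof -
  have "cn_P 7 4 p \<longleftrightarrow> circ_list p"
  proof (rule cn_P_iff_kernel [OF _ _ assms])
    fix p q :: "nat list"
    assume len: "length p = 7" and p: "circ_list p" and move: "cn_move 7 4 p q"
    have "length q = 7" using move by (simp add: cn_move_def)
    then obtain y0 y1 y2 y3 y4 y5 y6 where q: "q = [y0,y1,y2,y3,y4,y5,y6]" by (rule length_7E)
    obtain x0 x1 x2 x3 x4 x5 x6 where eq: "p = [x0,x1,x2,x3,x4,x5,x6]"
      using len by (rule length_7E)
    have "circ_S x0 x1 x2 x3 x4 x5 x6" using p unfolding eq circ_list_def by simp
    with move circ_S_below_unique [of x0 x1 x2 x3 x4 x5 x6 y0 y1 y2 y3 y4 y5 y6]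
    have "\<not> circ_S y0 y1 y2 y3 y4 y5 y6"
      unfolding eq q cn_move_7_4_iff by argo
    then show "\<not> circ_list q" unfolding q circ_list_def by simp
  next
    fix p :: "nat list"
    assume len: "length p = 7" and p: "\<not> circ_list p"
    obtain x0 x1 x2 x3 x4 x5 x6 where eq: "p = [x0,x1,x2,x3,x4,x5,x6]"
      using len by (rule length_7E)
    obtain y0 y1 y2 y3 y4 y5 y6 where y: "circ_S y0 y1 y2 y3 y4 y5 y6"
      and below: "y0 \<le> x0 \<and> y1 \<le> x1 \<and> y2 \<le> x2 \<and> y3 \<le> x3 \<and> y4 \<le> x4 \<and> y5 \<le> x5 \<and> y6 \<le> x6"
      and window: "y0 = x0 \<and> y1 = x1 \<and> y2 = x2
      \<or> y1 = x1 \<and> y2 = x2 \<and> y3 = x3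
      \<or> y2 = x2 \<and> y3 = x3 \<and> y4 = x4
      \<or> y3 = x3 \<and> y4 = x4 \<and> y5 = x5
      \<or> y4 = x4 \<and> y5 = x5 \<and> y6 = x6
      \<or> y5 = x5 \<and> y6 = x6 \<and> y0 = x0
      \<or> y6 = x6 \<and> y0 = x0 \<and> y1 = x1"
      using circ_S_below_exists [of x0 x1 x2 x3 x4 x5 x6] by blast
    have "circ_list [y0,y1,y2,y3,y4,y5,y6]" using y by (simp add: circ_list_def)
    \<comment> \<open>The lowered position satisfies \<open>circ_list\<close> and \<open>p\<close>
      does not, so they differ and the lowering is a legal move.\<close>
    moreover from this have "cn_move 7 4 p [y0,y1,y2,y3,y4,y5,y6]"
      unfolding eq cn_move_7_4_iff using p [unfolded eq] below window by auto
    ultimately show "\<exists>q. cn_move 7 4 p q \<and> circ_list q" by blast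
  qed
  then show ?thesis using cn74_S_iff_circ_list [OF assms] by simp
qed

end
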